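(* Let $P$ be a finite pure poset with rank $r$, and let $f$ be a function from $P$ to $\mathbb{N}_0$. Then the following two conditions are equivalent: (1) The function $f$ belongs to the chain semigroup $C_P$. (2) The following two statements hold: (a) for any $0\leq i,j\leq r$, $f(P_i)=f(P_j)$, i.e. $\sum_{x\in P_i}f(x)=\sum_{x\in P_j}f(x)$; (b) for any $0\leq i\leq r-1$ and any non-empty subset $V$ of $P_i$, $f(V)\leq f(N_P(V))$, i.e. $\sum_{x\in V}f(x)\leq \sum_{x\in N_P(V)}f(x)$.
   Context: $\mathbb{N}_0=\{0,1,2,\dots\}$ and $\mathbb{K}$ is a field. The length of a chain $C$ in a finite poset is $|C|-1$. A finite poset $P$ is pure of rank $r$ if every maximal chain of $P$ has length $r$. For $x<y$ in $P$, $y$ covers $x$ if there is no $z$ with $x<z<y$. A pure poset has a unique rank function $\rho:P\to\mathbb{N}_0$ with $\rho(m)=0$ for minimal $m$ and $\rho(y)=\rho(x)+1$ whenever $y$ covers $x$. Set $P_i=\{a\in P: \rho(a)=i\}$ for $0\le i\le r$. For $S\subseteq P_i$ with $0\le i\le r-1$, $N_P(S)$ is the set of elements of $P_{i+1}$ that cover some element of $S$. For a function $f$ on $P$ and $A\subseteq P$, $f(A)=\sum_{x\in A}f(x)$. Let $R=\mathbb{K}[x : x\in P]$ be the polynomial ring with variables the elements of $P$. To each maximal chain $C: x_0<x_1<\cdots<x_r$ associate the monomial $x_C=x_0x_1\cdots x_r\in R$. The chain algebra $\mathbb{K}[C_P]$ is the $\mathbb{K}$-subalgebra of $R$ generated by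 all $x_C$, with $C$ a maximal chain of $P$. The chain semigroup $C_P$ is the set of all functions $f:P\to\mathbb{N}_0$ such that $\prod_{x\in P}x^{f(x)}\in\mathbb{K}[C_P]$. *)

theory Defs
  imports Main "HOL.Hull" "HOL-Library.Poly_Mapping" "HOL-Library.FuncSet"
begin

text \<open>
  A finite poset is a finite set \<open>P\<close> in a type of class \<open>order\<close>, with the induced order.
  Functions on \<open>P\<close> are taken in \<open>P \<rightarrow>\<^sub>E UNIV\<close>, so that equality of functions is equality on \<open>P\<close>.
\<close>

abbreviation maximal_chain :: "'a::order set \<Rightarrow> 'a set \<Rightarrow> bool"
  where "maximal_chain P \<equiv> pred_on.maxchain P (<)"

text \<open>The length is an integer: the empty chain has length \<open>-1\<close>, so the empty poset is not pure of
  any rank \<open>r :: nat\<close>.\<close>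

definition chain_length :: "'a set \<Rightarrow> int"
  where "chain_length C = int (card C) - 1"

definition pure_of_rank :: "'a::order set \<Rightarrow> nat \<Rightarrow> bool"
  where "pure_of_rank P r \<longleftrightarrow> (\<forall>C. maximal_chain P C \<longrightarrow> chain_length C = int r)"

definition covers :: "'a::order set \<Rightarrow> 'a \<Rightarrow> 'a \<Rightarrow> bool"
  where "covers P y x \<longleftrightarrow> x \<in> P \<and> y \<in> P \<and> x < y \<and> \<not> (\<exists>z\<in>P. x < z \<and> z < y)"

definition minimal_in :: "'a::order set \<Rightarrow> 'a \<Rightarrow> bool"
  where "minimal_in P m \<longleftrightarrow> m \<in> P \<and> \<not> (\<exists>x\<in>P. x < m)"

definition is_rank_function :: "'a::order set \<Rightarrow> ('a \<Rightarrow> nat) \<Rightarrow> bool"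
  where "is_rank_function P \<rho> \<longleftrightarrow>
    \<rho> \<in> P \<rightarrow>\<^sub>E UNIV \<and>
    (\<forall>m. minimal_in P m \<longrightarrow> \<rho> m = 0) \<and>
    (\<forall>x y. covers P y x \<longrightarrow> \<rho> y = \<rho> x + 1)"

definition rank_function :: "'a::order set \<Rightarrow> 'a \<Rightarrow> nat"
  where "rank_function P = (THE \<rho>. is_rank_function P \<rho>)"

definition level :: "'a::order set \<Rightarrow> nat \<Rightarrow> 'a set"
  where "level P i = {a \<in> P. rank_function P a = i}"

text \<open>The argument \<open>i\<close> is the level containing \<open>S\<close>.\<close>

definition upper_nbrs :: "'a::order set \<Rightarrow> nat \<Rightarrow> 'a set \<Rightarrow> 'a set"
  where "upper_nbrs P i S = {y \<in> level P (i + 1). \<exists>x\<in>S. covers P y x}"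

text \<open>Polynomials with variables in \<open>'a\<close>: finitely supported coefficient functions on exponent
  vectors.\<close>

type_synonym ('a, 'k) mvpoly = "('a \<Rightarrow>\<^sub>0 nat) \<Rightarrow>\<^sub>0 'k"

definition Var :: "'a \<Rightarrow> ('a, 'k::field) mvpoly"
  where "Var x = Poly_Mapping.single (Poly_Mapping.single x 1) 1"

definition Const :: "'k::field \<Rightarrow> ('a, 'k) mvpoly"
  where "Const c = Poly_Mapping.single 0 c"

definition is_subalgebra :: "('a, 'k::field) mvpoly set \<Rightarrow> bool"
  where "is_subalgebra A \<longleftrightarrow>
    1 \<in> A \<and>
    (\<forall>p\<in>A. \<forall>q\<in>A. p + q \<in> A) \<and>
    (\<forall>p\<in>A. \<forall>q\<in>A. p * q \<in> A) \<and>
    (\<forall>c. \<forall>p\<in>A. Const c * p \<in> A)"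

definition chain_monomial :: "'a set \<Rightarrow> ('a, 'k::field) mvpoly"
  where "chain_monomial C = (\<Prod>x\<in>C. Var x)"

text \<open>The ambient ring has a variable for every element of \<open>'a\<close>, but the generators, hence all
  elements of the chain algebra, only involve variables in \<open>P\<close>.\<close>

definition chain_algebra :: "'a::order set \<Rightarrow> ('a, 'k::field) mvpoly set"
  where "chain_algebra P = is_subalgebra hull {chain_monomial C | C. maximal_chain P C}"

definition chain_semigroup :: "'k::field itself \<Rightarrow> 'a::order set \<Rightarrow> ('a \<Rightarrow> nat) set"
  where "chain_semigroup _ P =
    {f \<in> P \<rightarrow>\<^sub>E UNIV. (\<Prod>x\<in>P. Var x ^ f x) \<in> (chain_algebra P :: ('a, 'k) mvpoly set)}"

text \<open>\<^const>\<open>rank_function\<close> is well defined on finite pure posets.\<close>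

lemma chain_extends_to_maximal:
  fixes P :: "'a::order set"
  assumes "finite P" "pred_on.chain P (<) X"
  shows "\<exists>C. maximal_chain P C \<and> X \<subseteq> C"
proof -
  let ?S = "{C. pred_on.chain P (<) C \<and> X \<subseteq> C}"
  have "?S \<subseteq> Pow P" by (auto simp: pred_on.chain_def)
  then have "finite ?S" using assms(1) by (simp add: finite_subset)
  moreover have "X \<in> ?S" using assms(2) by simp
  ultimately have "\<exists>C\<in>?S. X \<subseteq> C \<and> (\<forall>D\<in>?S. C \<subseteq> D \<longrightarrow> C = D)"
    by (rule finite_has_maximal2)
  then obtain C where C: "pred_on.chain P (<) C" "X \<subseteq> C"
    and max: "\<And>D. pred_on.chain P (<) D \<Longrightarrow> X \<subseteq> D \<Longrightarrow> C \<subseteq> D \<Longrightarrow> C = D"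
    by auto
  have "maximal_chain P C"
    unfolding pred_on.maxchain_def
  proof (intro conjI notI)
    assume "\<exists>D. pred_on.chain P (<) D \<and> C \<subset> D"
    then obtain D where "pred_on.chain P (<) D" "C \<subset> D" by blast
    then show False using max[of D] C(2) by auto
  qed (rule C(1))
  with C(2) show ?thesis by blast
qed

lemma rank_function_ex1:
  fixes P :: "'a::order set"
  assumes fin: "finite P" and pure: "pure_of_rank P r"
  shows "\<exists>!\<rho>. is_rank_function P \<rho>"
proof (rule ex_ex1I)
  have finC: "finite C" if "maximal_chain P C" for C
    using that fin unfolding pred_on.maxchain_def pred_on.chain_def by (auto intro: finite_subset)
  have cardC: "card C = r + 1" if "maximal_chain P C" for C
    using pure that by (auto simp: pure_of_rank_def chain_length_def)
  have split: "card C = card (C \<inter> {..<x}) + 1 + card (D \<inter> {x<..})"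
    if "C = (C \<inter> {..<x}) \<union> {x} \<union> (D \<inter> {x<..})" "finite C" "finite D" for C D :: "'a set" and x
  proof -
    have "card ((C \<inter> {..<x}) \<union> {x} \<union> (D \<inter> {x<..}))
        = card ((C \<inter> {..<x}) \<union> {x}) + card (D \<inter> {x<..})"
      using that(2,3) by (intro card_Un_disjoint) auto
    also have "card ((C \<inter> {..<x}) \<union> {x}) = card (C \<inter> {..<x}) + 1"
      using that(2,3) by simp
    finally show ?thesis using that(1) by simp
  qed
  have indep: "card (C \<inter> {..<x}) = card (D \<inter> {..<x})"
    if C: "maximal_chain P C" and D: "maximal_chain P D" and x: "x \<in> C" "x \<in> D" for C D x
  proof -
    have tot: "\<And>a b. a \<in> C \<Longrightarrow> b \<in> C \<Longrightarrow> a < b \<or> a = b \<or> b < a"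
      "\<And>a b. a \<in> D \<Longrightarrow> b \<in> D \<Longrightarrow> a < b \<or> a = b \<or> b < a" "C \<subseteq> P" "D \<subseteq> P"
      using C D unfolding pred_on.maxchain_def pred_on.chain_def by auto
    define E where "E = (C \<inter> {..<x}) \<union> {x} \<union> (D \<inter> {x<..})"
    have "pred_on.chain P (<) E"
      unfolding pred_on.chain_def E_def using tot x
      by (auto dest: less_trans)
    then obtain F where F: "maximal_chain P F" "E \<subseteq> F"
      using chain_extends_to_maximal[OF fin] by blast
    have totF: "\<And>a b. a \<in> F \<Longrightarrow> b \<in> F \<Longrightarrow> a < b \<or> a = b \<or> b < a" and FP: "F \<subseteq> P"
      using F unfolding pred_on.maxchain_def pred_on.chain_def by auto
    have "x \<in> F" using F E_def by auto
    have "a \<in> E" if a: "a \<in> F" for a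
    proof -
      consider "a < x" | "a = x" | "x < a" using totF[OF a \<open>x \<in> F\<close>] by blast
      then show ?thesis
      proof cases
        case 1
        have "a < b \<or> a = b \<or> b < a" if b: "b \<in> C" for b
        proof (cases "x \<le> b")
          case True
          then show ?thesis using 1 by (auto dest: less_le_trans)
        next
          case False
          then have "b \<in> E" using tot(1)[OF b x(1)] b unfolding E_def by auto
          then show ?thesis using totF[OF a] F(2) by blast
        qed
        then have "pred_on.chain P (<) (insert a C)"
          unfolding pred_on.chain_def using tot(1,3) a FP by auto
        then have "a \<in> C" using C unfolding pred_on.maxchain_def by blast
        then show ?thesis using 1 by (simp add: E_def)
      next
        case 2 then show ?thesis by (simp add: E_def)
      next
        case 3
        have "a < b \<or> a = b \<or> b < a" if b: "b \<in> D" for b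
        proof (cases "b \<le> x")
          case True
          then show ?thesis using 3 by (auto dest: le_less_trans)
        next
          case False
          then have "b \<in> E" using tot(2)[OF b x(2)] b unfolding E_def by auto
          then show ?thesis using totF[OF a] F(2) by blast
        qed
        then have "pred_on.chain P (<) (insert a D)"
          unfolding pred_on.chain_def using tot(2,4) a FP by auto
        then have "a \<in> D" using D unfolding pred_on.maxchain_def by blast
        then show ?thesis using 3 by (simp add: E_def)
      qed
    qed
    then have "E = F" using F by auto
    then have E: "maximal_chain P E" using F by simp
    have EC: "E \<inter> {..<x} = C \<inter> {..<x}" by (auto simp: E_def dest: less_trans)
    have "card E = card (C \<inter> {..<x}) + 1 + card (D \<inter> {x<..})"
      using split[OF _ finC[OF E] finC[OF D], of x]
      unfolding EC by (simp only: E_def)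
    moreover have "D = (D \<inter> {..<x}) \<union> {x} \<union> (D \<inter> {x<..})" using tot(2) x(2) by auto
    then have "card D = card (D \<inter> {..<x}) + 1 + card (D \<inter> {x<..})"
      using split[of D x D] finC D by simp
    ultimately show ?thesis using cardC[OF E] cardC[OF D] by simp
  qed
  define K where "K x = (SOME C. maximal_chain P C \<and> x \<in> C)" for x
  have K: "maximal_chain P (K x) \<and> x \<in> K x" if "x \<in> P" for x
  proof -
    have "pred_on.chain P (<) {x}" using that by (simp add: pred_on.chain_def)
    then show ?thesis unfolding K_def
      using someI_ex[of "\<lambda>C. maximal_chain P C \<and> x \<in> C"] chain_extends_to_maximal[OF fin] by blast
  qed
  define \<rho> where "\<rho> = restrict (\<lambda>x. card (K x \<inter> {..<x})) P"
  have \<rho>: "\<rho> x = card (C \<inter> {..<x})" if "maximal_chain P C" "x \<in> C" for x C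
  proof -
    have "x \<in> P" using that unfolding pred_on.maxchain_def pred_on.chain_def by blast
    then show ?thesis using K[of x] indep[of "K x" C x] that by (simp add: \<rho>_def)
  qed
  have "is_rank_function P \<rho>"
    unfolding is_rank_function_def
  proof (intro conjI allI impI)
    show "\<rho> \<in> P \<rightarrow>\<^sub>E UNIV" by (simp add: \<rho>_def)
  next
    fix m assume m: "minimal_in P m"
    then have mP: "m \<in> P" by (simp add: minimal_in_def)
    have "K m \<subseteq> P" using K[OF mP] unfolding pred_on.maxchain_def pred_on.chain_def by blast
    then have "K m \<inter> {..<m} = {}" using m unfolding minimal_in_def by auto
    then show "\<rho> m = 0" using \<rho>[of "K m" m] K[OF mP] by simp
  next
    fix x y assume c: "covers P y x"
    then have "pred_on.chain P (<) {x, y}" by (auto simp: pred_on.chain_def covers_def)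
    then obtain C where C: "maximal_chain P C" "{x, y} \<subseteq> C"
      using chain_extends_to_maximal[OF fin] by blast
    have tot: "\<And>a b. a \<in> C \<Longrightarrow> b \<in> C \<Longrightarrow> a < b \<or> a = b \<or> b < a" and CP: "C \<subseteq> P"
      using C unfolding pred_on.maxchain_def pred_on.chain_def by auto
    have "C \<inter> {..<y} = insert x (C \<inter> {..<x})"
    proof (intro equalityI subsetI)
      fix a assume a: "a \<in> C \<inter> {..<y}"
      then have "\<not> x < a" using c CP unfolding covers_def by auto
      then show "a \<in> insert x (C \<inter> {..<x})" using a tot[of a x] C(2) by auto
    next
      fix a assume "a \<in> insert x (C \<inter> {..<x})"
      then show "a \<in> C \<inter> {..<y}" using c C(2) unfolding covers_def by (auto dest: less_trans)
    qed
    then show "\<rho> y = \<rho> x + 1" using \<rho>[OF C(1)] C finC[OF C(1)] by simp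
  qed
  then show "\<exists>\<rho>. is_rank_function P \<rho>" by blast
next
  fix \<rho> \<sigma> assume \<rho>: "is_rank_function P \<rho>" and \<sigma>: "is_rank_function P \<sigma>"
  have "x \<in> P \<longrightarrow> \<rho> x = \<sigma> x" for x
  proof (induction "card (P \<inter> {..<x})" arbitrary: x rule: less_induct)
    case less
    show ?case
    proof
      assume x: "x \<in> P"
      show "\<rho> x = \<sigma> x"
      proof (cases "minimal_in P x")
        case True
        then show ?thesis using \<rho> \<sigma> by (simp add: is_rank_function_def)
      next
        case False
        then have "P \<inter> {..<x} \<noteq> {}" using x by (auto simp: minimal_in_def)
        then obtain w where w: "w \<in> P \<inter> {..<x}" "\<And>z. z \<in> P \<inter> {..<x} \<Longrightarrow> w \<le> z \<Longrightarrow> w = z"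
          using finite_has_maximal[of "P \<inter> {..<x}"] fin by auto
        then have cov: "covers P x w"
          using x unfolding covers_def by (auto simp: less_le)
        have "P \<inter> {..<w} \<subset> P \<inter> {..<x}" using w(1) by (auto dest: less_trans)
        then have "card (P \<inter> {..<w}) < card (P \<inter> {..<x})"
          using fin by (intro psubset_card_mono) auto
        then have "\<rho> w = \<sigma> w" using less w(1) by blast
        then show ?thesis using \<rho> \<sigma> cov by (simp add: is_rank_function_def)
      qed
    qed
  qed
  then show "\<rho> = \<sigma>"
    using \<rho> \<sigma> unfolding is_rank_function_def by (intro PiE_ext[of \<rho> P "\<lambda>_. UNIV" \<sigma>]) auto
qed

end

theory Submission
  imports Defs
begin

text \<open>
  The chain algebra is spanned by monomials, so \<open>f\<close> lies in the chain semigroup iff it is a sum of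
  indicator functions of maximal chains. Such an indicator has total \<open>1\<close> on every level, and a
  maximal chain that meets a set \<open>V\<close> of one level meets the upper neighbours of \<open>V\<close>; both
  conditions are additive. Conversely, let \<open>n\<close> be the common total of \<open>f\<close> on the levels. Place
  \<open>n\<close> tokens on the bottom level, \<open>f x\<close> of them on each \<open>x\<close>. Condition (b) is Hall's condition for
  moving the tokens up one level along covers so that again \<open>f y\<close> of them land on each \<open>y\<close>. The
  paths of the tokens are \<open>n\<close> maximal chains whose indicators sum to \<open>f\<close>.
\<close>

section \<open>Hall's marriage theorem for finite families of finite sets\<close>

text \<open>Induction on the size of \<open>I\<close>. If some non-empty proper subfamily
  \<open>J\<close> is tight, meaning its union has exactly \<open>card J\<close> elements, then
  \<open>J\<close> and \<open>I - J\<close> are solved separately, the latter with the union over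
  \<open>J\<close> removed. If there is no tight subfamily, one choice can be made
  arbitrarily.\<close>

lemma hall_marriage:
  fixes A :: "'i \<Rightarrow> 'b set"
  assumes "finite I" and "\<And>i. i \<in> I \<Longrightarrow> finite (A i)"
    and "\<And>J. J \<subseteq> I \<Longrightarrow> card J \<le> card (\<Union>(A ` J))"
  shows "\<exists>R. (\<forall>i\<in>I. R i \<in> A i) \<and> inj_on R I"
  using assms
proof (induction "card I" arbitrary: I A rule: less_induct)
  case less
  note fin = \<open>finite I\<close> and finA = less.prems(2) and hall = less.prems(3)
  show ?case
  proof (cases "\<exists>J. J \<subset> I \<and> J \<noteq> {} \<and> card (\<Union>(A ` J)) = card J")
    case True
    then obtain J where J: "J \<subset> I" "J \<noteq> {}" "card (\<Union>(A ` J)) = card J" by blast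
    have finJ: "finite J" using J fin by (meson finite_subset psubset_imp_subset)
    define B where "B i = A i - \<Union>(A ` J)" for i
    have "card J < card I" using J fin by (simp add: psubset_card_mono)
    then have "\<exists>R. (\<forall>i\<in>J. R i \<in> A i) \<and> inj_on R J"
      using J finJ finA hall by (intro less.hyps) auto
    then obtain R where R: "\<And>i. i \<in> J \<Longrightarrow> R i \<in> A i" "inj_on R J" by blast
    have "card (I - J) < card I" using J fin by (intro psubset_card_mono) auto
    then have "\<exists>S. (\<forall>i\<in>I - J. S i \<in> B i) \<and> inj_on S (I - J)"
    proof (rule less.hyps)
      fix K assume K: "K \<subseteq> I - J"
      have finK: "finite K" using K fin by (meson finite_Diff finite_subset)
      \<comment> \<open>Hall's condition for \<open>B\<close> on \<open>K\<close> is that for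
        \<open>A\<close> on \<open>J \<union> K\<close>, with the tight part \<open>J\<close>
        cancelled on both sides.\<close>
      have "card J + card K = card (J \<union> K)"
        using K finJ finK by (intro card_Un_disjoint[symmetric]) auto
      also have "\<dots> \<le> card (\<Union>(A ` (J \<union> K)))"
        using K J by (intro hall) auto
      also have "\<Union>(A ` (J \<union> K)) = \<Union>(A ` J) \<union> \<Union>(B ` K)"
        by (auto simp: B_def)
      also have "card \<dots> \<le> card (\<Union>(A ` J)) + card (\<Union>(B ` K))"
        by (rule card_Un_le)
      finally show "card K \<le> card (\<Union>(B ` K))" using J(3) by simp
    qed (use fin finA in \<open>auto simp: B_def\<close>)
    then obtain S where S: "\<And>i. i \<in> I - J \<Longrightarrow> S i \<in> B i" "inj_on S (I - J)" by blast
    define T where "T i = (if i \<in> J then R i else S i)" for i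
    have "inj_on T I"
    proof (rule inj_onI)
      fix i j assume ij: "i \<in> I" "j \<in> I" "T i = T j"
      \<comment> \<open>The union over \<open>J\<close> separates the two partial choices:
        \<open>R\<close> takes its values inside it, \<open>S\<close> outside it.\<close>
      have *: "T a \<in> \<Union>(A ` J) \<longleftrightarrow> a \<in> J" if "a \<in> I" for a
        using that R(1)[of a] S(1)[of a] by (auto simp: T_def B_def)
      show "i = j"
      proof (cases "i \<in> J")
        case True
        then show ?thesis using * ij R(2) by (metis T_def inj_onD)
      next
        case False
        then show ?thesis using * ij S(2) by (metis DiffI T_def inj_onD)
      qed
    qed
    moreover have "T i \<in> A i" if "i \<in> I" for i
      using that R(1)[of i] S(1)[of i] by (auto simp: T_def B_def)
    ultimately show ?thesis by blast
  next
    case no_tight: False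
    show ?thesis
    proof (cases "I = {}")
      case False
      then obtain a where a: "a \<in> I" by blast
      have "card {a} \<le> card (\<Union>(A ` {a}))" using a by (intro hall) auto
      then obtain b where b: "b \<in> A a" by fastforce
      define B where "B i = A i - {b}" for i
      have "card (I - {a}) < card I" using fin a by (rule card_Diff1_less)
      then have "\<exists>S. (\<forall>i\<in>I - {a}. S i \<in> B i) \<and> inj_on S (I - {a})"
      proof (rule less.hyps)
        fix K assume K: "K \<subseteq> I - {a}"
        show "card K \<le> card (\<Union>(B ` K))"
        proof (cases "K = {}")
          case False
          \<comment> \<open>A non-empty \<open>K\<close> avoiding \<open>a\<close> is a proper
            subfamily, hence not tight. Its union has an element to spare, and removing
            \<open>b\<close> costs at most one.\<close>
          have "K \<subset> I" using K a by blast
          with False no_tight have "card K \<noteq> card (\<Union>(A ` K))"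
            by metis
          moreover have "card K \<le> card (\<Union>(A ` K))" using K by (intro hall) auto
          moreover have "\<Union>(B ` K) = \<Union>(A ` K) - {b}" by (auto simp: B_def)
          ultimately show ?thesis
            using card_Diff1_le diff_card_le_card_Diff[of "{b}" "\<Union>(A ` K)"] by simp
        qed simp
      qed (use fin finA in \<open>auto simp: B_def\<close>)
      then obtain S where S: "\<And>i. i \<in> I - {a} \<Longrightarrow> S i \<in> B i" "inj_on S (I - {a})" by blast
      have "inj_on (S(a := b)) I"
        using S by (auto simp: inj_on_def B_def)
      moreover have "(S(a := b)) i \<in> A i" if "i \<in> I" for i
        using that b S(1)[of i] by (auto simp: B_def)
      ultimately show ?thesis by blast
    qed auto
  qed
qed


section \<open>Maximal chains and the rank function of a pure poset\<close>

lemma maximal_chainD: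
  assumes "maximal_chain P C"
  shows "C \<subseteq> P" "\<And>x y. x \<in> C \<Longrightarrow> y \<in> C \<Longrightarrow> x < y \<or> x = y \<or> y < x"
    "\<And>z. z \<in> P \<Longrightarrow> (\<And>x. x \<in> C \<Longrightarrow> x < z \<or> x = z \<or> z < x) \<Longrightarrow> z \<in> C"
proof -
  have C: "pred_on.chain P (<) C" "\<And>D. pred_on.chain P (<) D \<Longrightarrow> \<not> C \<subset> D"
    using assms unfolding pred_on.maxchain_def by auto
  show "x < y \<or> x = y \<or> y < x" if "x \<in> C" "y \<in> C" for x y
    using C(1) that unfolding pred_on.chain_def by auto
  show "C \<subseteq> P" using C(1) unfolding pred_on.chain_def by auto
  fix z assume z: "z \<in> P" "\<And>x. x \<in> C \<Longrightarrow> x < z \<or> x = z \<or> z < x"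
  have "pred_on.chain P (<) (insert z C)"
    using C(1) z unfolding pred_on.chain_def by blast
  then show "z \<in> C" using C(2) by blast
qed

context
  fixes P :: "'a::order set" and r :: nat
  assumes fin: "finite P" and pure: "pure_of_rank P r"
begin

lemma finite_level: "finite (level P i)"
  using fin by (simp add: level_def)

lemma finite_maximal_chain: "maximal_chain P C \<Longrightarrow> finite C"
  using maximal_chainD(1) fin finite_subset by blast

lemma card_maximal_chain: "maximal_chain P C \<Longrightarrow> card C = r + 1"
  using pure by (auto simp: pure_of_rank_def chain_length_def)

lemma is_rank_function_rank_function: "is_rank_function P (rank_function P)"
  unfolding rank_function_def using rank_function_ex1[OF fin pure] by (rule theI')

lemma rank_minimal: "minimal_in P m \<Longrightarrow> rank_function P m = 0"
  and rank_covers: "covers P y x \<Longrightarrow> rank_function P y = rank_function P x + 1"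
  using is_rank_function_rank_function by (auto simp: is_rank_function_def)

text \<open>A maximal chain has no gaps: its least element is minimal in \<open>P\<close>, and each
  further element covers its predecessor in the chain. Hence the rank starts at 0 and grows by one
  along \<open>C\<close>.\<close>

lemma rank_in_maximal_chain:
  assumes C: "maximal_chain P C"
  shows "x \<in> C \<Longrightarrow> rank_function P x = card (C \<inter> {..<x})"
proof (induction "card (C \<inter> {..<x})" arbitrary: x rule: less_induct)
  case less
  note CD = maximal_chainD[OF C] and x = \<open>x \<in> C\<close>
  have finC: "finite C" by (rule finite_maximal_chain[OF C])
  show ?case
  proof (cases "C \<inter> {..<x} = {}")
    case True
    have "minimal_in P x"
      unfolding minimal_in_def
    proof (intro conjI notI)
      assume "\<exists>w\<in>P. w < x"
      then obtain w where w: "w \<in> P" "w < x" by blast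
      \<comment> \<open>Here \<open>x\<close> is the least element of \<open>C\<close>, so
        \<open>w\<close> lies below all of \<open>C\<close> and maximality would force
        \<open>w\<close> into \<open>C\<close>.\<close>
      have "y < w \<or> y = w \<or> w < y" if "y \<in> C" for y
      proof -
        have "\<not> y < x" using True that by auto
        then have "x \<le> y" using CD(2)[OF x that] by auto
        then show ?thesis using w by auto
      qed
      then have "w \<in> C" using w by (intro CD(3)) auto
      then show False using True w by auto
    qed (use x CD(1) in auto)
    then show ?thesis using True by (simp add: rank_minimal)
  next
    case False
    \<comment> \<open>\<open>w\<close> is the predecessor of \<open>x\<close> in
      \<open>C\<close>.\<close>
    obtain w where w: "w \<in> C \<inter> {..<x}" and max: "\<And>z. z \<in> C \<inter> {..<x} \<Longrightarrow> w \<le> z \<Longrightarrow> w = z"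
      using finite_has_maximal[of "C \<inter> {..<x}"] finC False by auto
    have below: "y \<le> w" if "y \<in> C" "y < x" for y
      using CD(2)[of y w] max[of y] that w by (auto simp: le_less)
    have "covers P x w"
      unfolding covers_def
    proof (intro conjI notI)
      assume "\<exists>z\<in>P. w < z \<and> z < x"
      then obtain z where z: "z \<in> P" "w < z" "z < x" by blast
      \<comment> \<open>Elements of \<open>C\<close> lie either at or below \<open>w\<close>, or at
        or above \<open>x\<close>, so \<open>z\<close> is comparable to all of them.\<close>
      have "y < z \<or> y = z \<or> z < y" if "y \<in> C" for y
      proof (cases "y < x")
        case True
        then show ?thesis using below[OF that] z by auto
      next
        case False
        then have "x \<le> y" using CD(2)[OF x that] by auto
        then show ?thesis using z by auto
      qed
      then have "z \<in> C" using z by (intro CD(3)) auto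
      then show False using below[of z] z by auto
    qed (use w x CD(1) in auto)
    moreover have eq: "C \<inter> {..<x} = insert w (C \<inter> {..<w})"
      using w below by (auto dest: less_trans simp: le_less)
    then have card: "card (C \<inter> {..<x}) = Suc (card (C \<inter> {..<w}))"
      using finC by simp
    moreover have "rank_function P w = card (C \<inter> {..<w})"
      using w card by (intro less.hyps) auto
    ultimately show ?thesis by (simp add: rank_covers)
  qed
qed

lemma maximal_chain_through:
  assumes "x \<in> P"
  obtains C where "maximal_chain P C" "x \<in> C"
  using assms chain_extends_to_maximal[OF fin, of "{x}"] by (auto simp: pred_on.chain_def)

text \<open>Two comparable elements lie on a common maximal chain, where the rank counts the chain
  elements below.\<close>

lemma rank_strict_mono:
  assumes "x \<in> P" "y \<in> P" "x < y"
  shows "rank_function P x < rank_function P y"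
proof -
  have "pred_on.chain P (<) {x, y}" using assms by (auto simp: pred_on.chain_def)
  then obtain C where C: "maximal_chain P C" "{x, y} \<subseteq> C"
    using chain_extends_to_maximal[OF fin] by blast
  have "C \<inter> {..<x} \<subset> C \<inter> {..<y}" using assms C by auto
  then have "card (C \<inter> {..<x}) < card (C \<inter> {..<y})"
    using finite_maximal_chain[OF C(1)] by (intro psubset_card_mono) auto
  then show ?thesis using rank_in_maximal_chain[OF C(1)] C(2) by simp
qed

text \<open>The \<open>r + 1\<close> elements of \<open>C\<close> have distinct ranks, all at most
  \<open>r\<close>, so every rank from 0 to \<open>r\<close> occurs.\<close>

lemma bij_betw_rank_maximal_chain:
  assumes C: "maximal_chain P C"
  shows "bij_betw (rank_function P) C {..r}"
proof -
  note CD = maximal_chainD[OF C]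
  have inj: "inj_on (rank_function P) C"
    using CD(1,2) rank_strict_mono by (intro inj_onI) (metis less_irrefl subsetD)
  have "rank_function P x \<le> r" if x: "x \<in> C" for x
  proof -
    have "C \<inter> {..<x} \<subset> C" using x by auto
    then have "card (C \<inter> {..<x}) < card C"
      using finite_maximal_chain[OF C] by (intro psubset_card_mono)
    then show ?thesis using rank_in_maximal_chain[OF C x] card_maximal_chain[OF C] by simp
  qed
  then have "rank_function P ` C \<subseteq> {..r}" by auto
  moreover have "card (rank_function P ` C) = card {..r}"
    using card_image[OF inj] card_maximal_chain[OF C] by simp
  ultimately show ?thesis using inj by (simp add: bij_betw_def card_subset_eq)
qed

lemma rank_le:
  assumes "x \<in> P"
  shows "rank_function P x \<le> r"
proof -
  obtain C where "maximal_chain P C" "x \<in> C" using assms by (rule maximal_chain_through)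
  then show ?thesis using bij_betw_rank_maximal_chain bij_betwE by blast
qed

lemma card_maximal_chain_Int_level:
  assumes C: "maximal_chain P C" and "i \<le> r"
  shows "card (C \<inter> level P i) = 1"
proof -
  have bij: "bij_betw (rank_function P) C {..r}" by (rule bij_betw_rank_maximal_chain[OF C])
  then obtain x where x: "x \<in> C" "rank_function P x = i"
    using \<open>i \<le> r\<close> by (metis atMost_iff bij_betw_iff_bijections)
  have "C \<inter> level P i = {x}"
    using x bij maximal_chainD(1)[OF C] by (auto simp: level_def bij_betw_def dest: inj_onD)
  then show ?thesis by simp
qed

text \<open>\<open>C\<close> meets \<open>V\<close> at most once. If it does so in \<open>x\<close>,
  the element of \<open>C\<close> on the next level covers \<open>x\<close>, because an element
  strictly between would have a rank strictly between \<open>i\<close> and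
  \<open>i + 1\<close>.\<close>

lemma card_maximal_chain_Int_upper_nbrs:
  assumes C: "maximal_chain P C" and "i < r" and V: "V \<subseteq> level P i"
  shows "card (C \<inter> V) \<le> card (C \<inter> upper_nbrs P i V)"
proof (cases "C \<inter> V = {}")
  case False
  note CD = maximal_chainD[OF C]
  have finC: "finite C" by (rule finite_maximal_chain[OF C])
  obtain x where x: "x \<in> C" "x \<in> V" using False by blast
  have "card (C \<inter> level P (i + 1)) = 1"
    using \<open>i < r\<close> by (intro card_maximal_chain_Int_level[OF C]) simp
  then obtain y where y: "y \<in> C" "y \<in> level P (i + 1)"
    by (metis IntE card_1_singletonE insertI1)
  have P: "x \<in> P" "y \<in> P" using x y CD(1) by auto
  have rk: "rank_function P x = i" "rank_function P y = i + 1"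
    using x y V by (auto simp: level_def)
  then have "x < y" using CD(2)[OF x(1) y(1)] rank_strict_mono[OF P(2,1)] by auto
  then have "covers P y x"
    unfolding covers_def
  proof (intro conjI notI)
    assume "\<exists>z\<in>P. x < z \<and> z < y"
    then obtain z where "z \<in> P" "x < z" "z < y" by blast
    then show False using rank_strict_mono[of x z] rank_strict_mono[of z y] P rk by linarith
  qed (use P in auto)
  then have "y \<in> C \<inter> upper_nbrs P i V" using x y by (auto simp: upper_nbrs_def)
  then have "0 < card (C \<inter> upper_nbrs P i V)" using finC by (auto simp: card_gt_0_iff)
  moreover have "card (C \<inter> V) \<le> card (C \<inter> level P i)"
    using V finC by (intro card_mono) auto
  then have "card (C \<inter> V) \<le> 1"
    using card_maximal_chain_Int_level[OF C, of i] \<open>i < r\<close> by simp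
  ultimately show ?thesis by linarith
qed simp

text \<open>The sequence is strictly increasing, so its image has \<open>r + 1\<close> elements. By
  purity this is already the size of every maximal chain extending it.\<close>

lemma maximal_chain_of_covers:
  assumes "\<And>i. i \<le> r \<Longrightarrow> e i \<in> P" and "\<And>i. i < r \<Longrightarrow> covers P (e (Suc i)) (e i)"
  shows "maximal_chain P (e ` {..r})"
proof -
  have mono: "e i < e j" if "i < j" "j \<le> r" for i j
    using that
  proof (induction j)
    case (Suc j)
    have "e j < e (Suc j)" using assms(2)[of j] Suc.prems by (simp add: covers_def)
    then show ?case
      using Suc by (cases "i = j") (auto intro: less_trans)
  qed simp
  have "pred_on.chain P (<) (e ` {..r})"
    unfolding pred_on.chain_def using assms(1) mono by (auto, metis nat_neq_iff)
  then obtain C where C: "maximal_chain P C" "e ` {..r} \<subseteq> C"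
    using chain_extends_to_maximal[OF fin] by blast
  have "inj_on e {..r}"
    using mono by (intro inj_onI) (metis atMost_iff less_irrefl nat_neq_iff)
  then have "card (e ` {..r}) = card C"
    using card_maximal_chain[OF C(1)] by (simp add: card_image)
  then have "e ` {..r} = C"
    using C finite_maximal_chain by (intro card_subset_eq) auto
  then show ?thesis using C(1) by simp
qed

end

section \<open>Monomials of the chain algebra\<close>

text \<open>These are the exponent vectors of products of generators of the chain algebra, that is,
  sums of indicator functions of maximal chains with repetition allowed.\<close>

inductive_set chain_sums :: "'a::order set \<Rightarrow> ('a \<Rightarrow>\<^sub>0 nat) set" for P where
  zero: "0 \<in> chain_sums P"
| add: "maximal_chain P C \<Longrightarrow> g \<in> chain_sums P \<Longrightarrow>
    (\<Sum>x\<in>C. Poly_Mapping.single x 1) + g \<in> chain_sums P"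

lemma chain_sums_add:
  assumes "g \<in> chain_sums P" "h \<in> chain_sums P"
  shows "g + h \<in> chain_sums P"
  using assms by induction (simp_all add: add.assoc chain_sums.add del: One_nat_def)

lemma chain_sums_sum:
  assumes "\<And>k. k \<in> K \<Longrightarrow> maximal_chain P (C k)"
  shows "(\<Sum>k\<in>K. \<Sum>x\<in>C k. Poly_Mapping.single x 1) \<in> chain_sums P"
  using assms
  by (induction K rule: infinite_finite_induct)
    (simp_all add: chain_sums.intros del: One_nat_def)

lemma lookup_sum_single:
  assumes "finite A"
  shows "Poly_Mapping.lookup (\<Sum>x\<in>A. Poly_Mapping.single x (f x)) y = (if y \<in> A then f y else 0)"
  using assms by (simp add: lookup_sum lookup_single when_def)

lemma prod_Var_power:
  "(\<Prod>x\<in>A. Var x ^ f x :: ('a, 'k::field) mvpoly)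
    = Poly_Mapping.single (\<Sum>x\<in>A. Poly_Mapping.single x (f x)) 1"
proof -
  have "(Var x ^ n :: ('a, 'k) mvpoly) = Poly_Mapping.single (Poly_Mapping.single x n) 1"
    for x :: 'a and n
    by (induction n) (auto simp: Var_def mult_single single_add[symmetric])
  then show ?thesis
    by (induction A rule: infinite_finite_induct) (auto simp: mult_single)
qed

lemma chain_monomial_eq_single:
  "(chain_monomial C :: ('a, 'k::field) mvpoly)
    = Poly_Mapping.single (\<Sum>x\<in>C. Poly_Mapping.single x 1) 1"
  using prod_Var_power[of "\<lambda>_. 1" C] by (simp add: chain_monomial_def)

lemma is_subalgebra_chain_algebra:
  "is_subalgebra (chain_algebra P :: ('a::order, 'k::field) mvpoly set)"
  unfolding chain_algebra_def by (rule hull_in) (auto simp: is_subalgebra_def)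

text \<open>From left to right, the polynomials supported on \<open>chain_sums P\<close> form a
  subalgebra containing the generators, hence contain the chain algebra; since 1 is non-zero,
  \<open>g\<close> is in the support of its monomial. From right to left, each added chain
  multiplies the monomial by a generator.\<close>

lemma single_in_chain_algebra_iff:
  "(Poly_Mapping.single g 1 :: ('a::order, 'k::field) mvpoly) \<in> chain_algebra P
    \<longleftrightarrow> g \<in> chain_sums P"
proof
  let ?A = "{p :: ('a, 'k) mvpoly. Poly_Mapping.keys p \<subseteq> chain_sums P}"
  have "p * q \<in> ?A" if "p \<in> ?A" "q \<in> ?A" for p q
    using keys_mult[of p q] that chain_sums_add by blast
  moreover have "Const c \<in> ?A" for c
    by (simp add: Const_def chain_sums.zero)
  moreover have "p + q \<in> ?A" if "p \<in> ?A" "q \<in> ?A" for p q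
    using keys_add[of p q] that by blast
  moreover have "1 \<in> ?A" by (simp add: chain_sums.zero)
  ultimately have "is_subalgebra ?A" unfolding is_subalgebra_def by blast
  moreover have "{chain_monomial C | C. maximal_chain P C} \<subseteq> ?A"
    using chain_sums.add[OF _ chain_sums.zero] by (auto simp: chain_monomial_eq_single)
  ultimately have "chain_algebra P \<subseteq> ?A"
    unfolding chain_algebra_def by (rule hull_minimal[rotated])
  then show "g \<in> chain_sums P" if "(Poly_Mapping.single g 1 :: ('a, 'k) mvpoly) \<in> chain_algebra P"
    using that by auto
next
  note alg = is_subalgebra_chain_algebra[of P, where 'k = 'k, unfolded is_subalgebra_def]
  assume "g \<in> chain_sums P"
  then show "(Poly_Mapping.single g 1 :: ('a, 'k) mvpoly) \<in> chain_algebra P"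
  proof induction
    case zero
    then show ?case using alg by simp
  next
    case (add C g)
    have "(chain_monomial C :: ('a, 'k) mvpoly) \<in> chain_algebra P"
      unfolding chain_algebra_def using add(1) by (intro hull_inc) auto
    then have "(chain_monomial C * Poly_Mapping.single g 1 :: ('a, 'k) mvpoly) \<in> chain_algebra P"
      using add alg by blast
    then show ?case by (simp add: chain_monomial_eq_single mult_single)
  qed
qed

section \<open>Necessity of the two conditions\<close>

text \<open>Induction on the chains: a further chain adds 1 to every level total and adds to the sum
  over \<open>V\<close> at most what it adds over the upper neighbours. The common total
  \<open>n\<close> is the number of chains used.\<close>

lemma chain_sums_level_conditions:
  assumes P: "finite P" "pure_of_rank P r" and "g \<in> chain_sums P"
  shows "(\<exists>n. \<forall>i\<le>r. sum (Poly_Mapping.lookup g) (level P i) = n) \<and>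
    (\<forall>i<r. \<forall>V. V \<subseteq> level P i \<longrightarrow>
      sum (Poly_Mapping.lookup g) V \<le> sum (Poly_Mapping.lookup g) (upper_nbrs P i V))"
  using assms(3)
proof induction
  case zero
  then show ?case by simp
next
  case (add C g)
  let ?h = "(\<Sum>x\<in>C. Poly_Mapping.single x 1) + g :: 'a \<Rightarrow>\<^sub>0 nat"
  have finC: "finite C" by (rule finite_maximal_chain[OF P add(1)])
  have sum_h: "sum (Poly_Mapping.lookup ?h) A = card (C \<inter> A) + sum (Poly_Mapping.lookup g) A"
    if "finite A" for A
    using that by (simp add: lookup_add lookup_sum_single[OF finC] sum.distrib
        sum.If_cases Int_def conj_commute)
  have fin: "finite V" "finite (upper_nbrs P i V)" if "V \<subseteq> level P i" for i V
    using that finite_level[OF P] by (auto simp: upper_nbrs_def intro: finite_subset)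
  from add.IH obtain n where n: "\<And>i. i \<le> r \<Longrightarrow> sum (Poly_Mapping.lookup g) (level P i) = n"
    by blast
  have "sum (Poly_Mapping.lookup ?h) (level P i) = Suc n" if "i \<le> r" for i
    using that n finite_level[OF P] card_maximal_chain_Int_level[OF P add(1)] 
    unfolding sum_h[OF finite_level[OF P]] by simp
  moreover have "sum (Poly_Mapping.lookup ?h) V \<le> sum (Poly_Mapping.lookup ?h) (upper_nbrs P i V)"
    if "i < r" "V \<subseteq> level P i" for i V
    unfolding sum_h[OF fin(1)[OF that(2)]] sum_h[OF fin(2)[OF that(2)]]
    using that card_maximal_chain_Int_upper_nbrs[OF P add(1) that] add.IH
    by (simp add: add_mono)
  ultimately show ?case by blast
qed

section \<open>Sufficiency: moving tokens upwards through the levels\<close>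

text \<open>The set of pairs models the multiset containing \<open>f x\<close> copies of each
  \<open>x\<close>, the second component numbering the copies. Forgetting that number turns an
  enumeration of the pairs into a sequence with multiplicities \<open>f\<close>.\<close>

lemma card_fst_fibre:
  fixes f :: "'a \<Rightarrow> nat" and n :: nat
  assumes h: "bij_betw h {..<n} (SIGMA x:A. {..<f x})" and x: "x \<in> A"
  shows "card {k. k < n \<and> fst (h k) = x} = f x"
proof -
  let ?K = "{k. k < n \<and> fst (h k) = x}"
  have "h ` ?K = {p \<in> h ` {..<n}. fst p = x}" by auto
  also have "\<dots> = {p \<in> (SIGMA x:A. {..<f x}). fst p = x}"
    using h by (simp add: bij_betw_def)
  also have "\<dots> = {x} \<times> {..<f x}" using x by auto
  finally have "h ` ?K = {x} \<times> {..<f x}" .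
  moreover have "inj_on h ?K"
    using h by (auto simp: bij_betw_def intro: inj_on_subset)
  ultimately show ?thesis using card_image[of h ?K] by simp
qed

lemma enumerate_with_multiplicity:
  fixes f :: "'a \<Rightarrow> nat"
  assumes "finite A"
  shows "\<exists>e. (\<forall>k<sum f A. e k \<in> A) \<and> (\<forall>x\<in>A. card {k. k < sum f A \<and> e k = x} = f x)"
proof -
  have "card (SIGMA x:A. {..<f x}) = sum f A" using assms by simp
  then obtain h where h: "bij_betw h {..<sum f A} (SIGMA x:A. {..<f x})"
    using assms by (metis card_lessThan finite_SigmaI finite_lessThan finite_same_card_bij)
  show ?thesis
  proof (intro exI[of _ "\<lambda>k. fst (h k)"] conjI ballI allI impI)
    show "fst (h k) \<in> A" if "k < sum f A" for k
    proof -
      have "h k \<in> (SIGMA x:A. {..<f x})" using bij_betwE[OF h] that by simp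
      then show ?thesis by auto
    qed
    show "card {k. k < sum f A \<and> fst (h k) = x} = f x" if "x \<in> A" for x
      using h that by (rule card_fst_fibre)
  qed
qed

text \<open>Hall's theorem is applied to \<open>n\<close> tokens, token \<open>k\<close> lying on \<open>e k\<close>, and the \<open>n\<close> copies of the
  elements of \<open>B\<close>: a transversal is then a bijection, so the multiplicities on \<open>B\<close> come out as \<open>f\<close>.\<close>

lemma extend_enumeration:
  fixes f :: "'a \<Rightarrow> nat" and rel :: "'a \<Rightarrow> 'a \<Rightarrow> bool"
  assumes "finite A" "finite B" and n: "sum f B = n"
    and e: "\<And>k. k < n \<Longrightarrow> e k \<in> A" "\<And>x. x \<in> A \<Longrightarrow> card {k. k < n \<and> e k = x} = f x"
    and hall: "\<And>V. V \<subseteq> A \<Longrightarrow> sum f V \<le> sum f {y \<in> B. \<exists>x\<in>V. rel x y}"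
  shows "\<exists>e'. (\<forall>k<n. e' k \<in> B \<and> rel (e k) (e' k)) \<and>
    (\<forall>y\<in>B. card {k. k < n \<and> e' k = y} = f y)"
proof -
  define S where "S k = (SIGMA y:{y \<in> B. rel (e k) y}. {..<f y})" for k
  have "\<exists>R. (\<forall>k\<in>{..<n}. R k \<in> S k) \<and> inj_on R {..<n}"
  proof (rule hall_marriage)
    fix J assume J: "J \<subseteq> {..<n}"
    have eJ: "e ` J \<subseteq> A" using J e(1) by auto
    \<comment> \<open>The tokens in \<open>J\<close> are among all tokens on the positions occupied
      by \<open>J\<close>, and the number of the latter is the sum of \<open>f\<close> over these
      positions.\<close>
    have "card J \<le> card (\<Union>x\<in>e ` J. {k. k < n \<and> e k = x})"
      using J by (intro card_mono finite_subset[OF _ finite_lessThan[of n]]) auto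
    also have "\<dots> \<le> (\<Sum>x\<in>e ` J. card {k. k < n \<and> e k = x})"
      using finite_subset[OF eJ \<open>finite A\<close>] by (rule card_UN_le)
    also have "\<dots> = sum f (e ` J)" using e(2) eJ by (intro sum.cong) auto
    also have "\<dots> \<le> sum f {y \<in> B. \<exists>x\<in>e ` J. rel x y}" by (rule hall[OF eJ])
    also have "\<dots> = card (SIGMA y:{y \<in> B. \<exists>x\<in>e ` J. rel x y}. {..<f y})"
      using \<open>finite B\<close> by simp
    also have "(SIGMA y:{y \<in> B. \<exists>x\<in>e ` J. rel x y}. {..<f y}) = \<Union>(S ` J)"
      by (auto simp: S_def)
    finally show "card J \<le> card (\<Union>(S ` J))" .
  qed (use \<open>finite B\<close> in \<open>auto simp: S_def\<close>)
  then obtain R where R: "\<And>k. k < n \<Longrightarrow> R k \<in> S k" and inj: "inj_on R {..<n}" by auto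
  have "S k \<subseteq> (SIGMA y:B. {..<f y})" for k by (auto simp: S_def)
  then have "R ` {..<n} \<subseteq> (SIGMA y:B. {..<f y})" using R by blast
  \<comment> \<open>There are \<open>n\<close> tokens and \<open>sum f B = n\<close> copies, so the
    injective \<open>R\<close> uses every copy.\<close>
  moreover have "card (R ` {..<n}) = card (SIGMA y:B. {..<f y})"
    using card_image[OF inj] n \<open>finite B\<close> by simp
  ultimately have img: "R ` {..<n} = (SIGMA y:B. {..<f y})"
    using \<open>finite B\<close> by (intro card_subset_eq) auto
  have "card {k. k < n \<and> fst (R k) = y} = f y" if "y \<in> B" for y
    using that by (rule card_fst_fibre[OF bij_betw_imageI[OF inj img]])
  moreover have "fst (R k) \<in> B \<and> rel (e k) (fst (R k))" if "k < n" for k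
    using R[OF that] by (auto simp: S_def)
  ultimately show ?thesis by (intro exI[of _ "\<lambda>k. fst (R k)"]) simp
qed

lemma level_conditions_imp_chain_sums:
  fixes P :: "'a::order set" and f :: "'a \<Rightarrow> nat"
  assumes P: "finite P" "pure_of_rank P r"
    and a: "\<And>i. i \<le> r \<Longrightarrow> sum f (level P i) = n"
    and b: "\<And>i V. i < r \<Longrightarrow> V \<subseteq> level P i \<Longrightarrow> sum f V \<le> sum f (upper_nbrs P i V)"
  shows "(\<Sum>x\<in>P. Poly_Mapping.single x (f x)) \<in> chain_sums P"
proof -
  \<comment> \<open>\<open>good\<close> describes a correct placement of the tokens on level
    \<open>i\<close>, and \<open>step\<close> a move along covers. Dependent choice produces an
    infinite sequence of placements, so both are made vacuous beyond the top level.\<close>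
  define good where "good i e \<longleftrightarrow> i \<le> r \<longrightarrow>
    (\<forall>k<n. e k \<in> level P i) \<and> (\<forall>x\<in>level P i. card {k. k < n \<and> e k = x} = f x)" for i e
  define step where "step i e e' \<longleftrightarrow> i < r \<longrightarrow> (\<forall>k<n. covers P (e' k) (e k))"
    for i and e e' :: "nat \<Rightarrow> 'a"
  have "\<exists>e. good 0 e"
    using enumerate_with_multiplicity[OF finite_level[OF P, of 0], of f] a[of 0]
    by (auto simp: good_def)
  moreover have "\<exists>e'. good (Suc i) e' \<and> step i e e'" if "good i e" for i e
  proof (cases "i < r")
    case True
    have "\<exists>e'. (\<forall>k<n. e' k \<in> level P (Suc i) \<and> covers P (e' k) (e k)) \<and>
      (\<forall>y\<in>level P (Suc i). card {k. k < n \<and> e' k = y} = f y)"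
    proof (rule extend_enumeration[where A = "level P i"])
      show "sum f V \<le> sum f {y \<in> level P (Suc i). \<exists>x\<in>V. covers P y x}"
        if "V \<subseteq> level P i" for V
        using b[OF True that] by (simp add: upper_nbrs_def)
    qed (use that True finite_level[OF P] a[of "Suc i"] in \<open>auto simp: good_def\<close>)
    then show ?thesis using True by (auto simp: good_def step_def)
  qed (auto simp: good_def step_def)
  ultimately obtain e where e: "\<And>i. good i (e i)" "\<And>i. step i (e i) (e (Suc i))"
    using dependent_nat_choice[of good step] by blast
  \<comment> \<open>\<open>C k\<close> is the path of token \<open>k\<close>.\<close>
  define C where "C k = (\<lambda>i. e i k) ` {..r}" for k
  have mem: "e i k \<in> level P i" if "i \<le> r" "k < n" for i k
    using e(1)[of i] that by (simp add: good_def)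
  have C: "maximal_chain P (C k)" if "k < n" for k
    unfolding C_def
  proof (rule maximal_chain_of_covers[OF P])
    show "e i k \<in> P" if "i \<le> r" for i
      using mem[OF that \<open>k < n\<close>] by (simp add: level_def)
    show "covers P (e (Suc i) k) (e i k)" if "i < r" for i
      using e(2)[of i] that \<open>k < n\<close> by (simp add: step_def)
  qed
  have "(\<Sum>x\<in>P. Poly_Mapping.single x (f x)) = (\<Sum>k<n. \<Sum>x\<in>C k. Poly_Mapping.single x 1)"
  proof (rule poly_mapping_eqI)
    fix x
    have "Poly_Mapping.lookup (\<Sum>k<n. \<Sum>x\<in>C k. Poly_Mapping.single x (1::nat)) x
        = (\<Sum>k<n. if x \<in> C k then 1 else 0)"
      unfolding lookup_sum[of _ "{..<n}"]
      by (intro sum.cong refl lookup_sum_single) (simp add: C_def)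
    also have "\<dots> = card {k. k < n \<and> x \<in> C k}"
      by (simp add: sum.If_cases Int_def)
    also have "\<dots> = (if x \<in> P then f x else 0)"
    proof (cases "x \<in> P")
      case True
      define i where "i = rank_function P x"
      have i: "i \<le> r" "x \<in> level P i"
        using rank_le[OF P True] True by (auto simp: i_def level_def)
      \<comment> \<open>The path of a token visits level \<open>j\<close> only at time
        \<open>j\<close>, so it can pass through \<open>x\<close> only at time \<open>i\<close>, the
        rank of \<open>x\<close>. Exactly \<open>f x\<close> tokens are there at that time.\<close>
      have "x \<in> C k \<longleftrightarrow> e i k = x" if "k < n" for k
      proof
      assume "x \<in> C k"
      then obtain j where "j \<le> r" "x = e j k" by (auto simp: C_def)
      then show "e i k = x" using mem[of j k] that by (auto simp: level_def i_def)
    qed (use i in \<open>auto simp: C_def\<close>)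
      then have "{k. k < n \<and> x \<in> C k} = {k. k < n \<and> e i k = x}" by blast
      then show ?thesis using e(1)[of i] i True by (simp add: good_def)
    next
      case False
      then have "{k. k < n \<and> x \<in> C k} = {}" using maximal_chainD(1)[OF C] by blast
      then show ?thesis using False by simp
    qed
    finally show "Poly_Mapping.lookup (\<Sum>x\<in>P. Poly_Mapping.single x (f x)) x
        = Poly_Mapping.lookup (\<Sum>k<n. \<Sum>x\<in>C k. Poly_Mapping.single x 1) x"
      unfolding lookup_sum_single[OF P(1)] by simp
  qed
  then show ?thesis using chain_sums_sum[of "{..<n}" P C] C by simp
qed

section \<open>From functions on the poset to exponent vectors\<close>

theorem theorem3p1:
  fixes P :: "'a::order set" and r :: nat and f :: "'a \<Rightarrow> nat"
  assumes "finite P" and "pure_of_rank P r" and "f \<in> P \<rightarrow>\<^sub>E UNIV"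
  shows "f \<in> chain_semigroup TYPE('k::field) P \<longleftrightarrow>
    (\<forall>i\<le>r. \<forall>j\<le>r. (\<Sum>x\<in>level P i. f x) = (\<Sum>x\<in>level P j. f x)) \<and>
    (\<forall>i<r. \<forall>V. V \<subseteq> level P i \<and> V \<noteq> {} \<longrightarrow>
       (\<Sum>x\<in>V. f x) \<le> (\<Sum>x\<in>upper_nbrs P i V. f x))"
    (is "_ \<longleftrightarrow> ?a \<and> ?b")
proof -
  define g where "g = (\<Sum>x\<in>P. Poly_Mapping.single x (f x))"
  have mem: "f \<in> chain_semigroup TYPE('k) P \<longleftrightarrow> g \<in> chain_sums P"
    using assms(3) by (simp add: chain_semigroup_def prod_Var_power g_def single_in_chain_algebra_iff)
  \<comment> \<open>Restricted to subsets of \<open>P\<close>: outside \<open>P\<close> the exponent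
    vector \<open>g\<close> is 0, whereas \<open>f\<close> takes the value
    \<open>undefined\<close>.\<close>
  have sum_g: "sum (Poly_Mapping.lookup g) A = sum f A" if "A \<subseteq> P" for A
    unfolding g_def lookup_sum_single[OF assms(1)] using that by (intro sum.cong) auto
  have sub: "level P i \<subseteq> P" "upper_nbrs P i V \<subseteq> P" for i V
    by (auto simp: level_def upper_nbrs_def)
  have "?a \<and> ?b" if "g \<in> chain_sums P"
  proof -
    note * = chain_sums_level_conditions[OF assms(1,2) that]
    from * have "?a" by (auto simp: sum_g[OF sub(1)])
    moreover have "?b"
      using * sum_g[OF sub(2)] sum_g[OF order_trans[OF _ sub(1)]] by metis
    ultimately show ?thesis by blast
  qed
  moreover have "g \<in> chain_sums P" if "?a" "?b"
    unfolding g_def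
  proof (rule level_conditions_imp_chain_sums[OF assms(1,2)])
    show "sum f (level P i) = sum f (level P 0)" if "i \<le> r" for i
      using \<open>?a\<close> that by blast
    \<comment> \<open>The empty set is not covered by (b), but both of its sums are 0.\<close>
    show "sum f V \<le> sum f (upper_nbrs P i V)" if "i < r" "V \<subseteq> level P i" for i V
      using \<open>?b\<close> that by (cases "V = {}") auto
  qed
  ultimately show ?thesis using mem by blast
qed

end
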